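(* Let $\mathfrak g$ and $\mathfrak g'$ be solvable singular quadratic Lie algebras. Then $\mathfrak g$ and $\mathfrak g'$ are isomorphic as Lie algebras if and only if they are i-isomorphic. Therefore the set $\widehat{\mathscr S_{\mathrm s}}(n+2)$ of isomorphism classes and the set $\widehat{\mathscr S_{\mathrm s}}^{\mathrm i}(n+2)$ of i-isomorphism classes of solvable singular quadratic Lie algebra structures on $\mathbb C^{n+2}$ coincide.
   Context: All vector spaces are finite-dimensional over $\mathbb C$. A quadratic Lie algebra $(\mathfrak g,B)$ is a Lie algebra with a non-degenerate symmetric invariant bilinear form ($B([X,Y],Z)=B(X,[Y,Z])$). An i-isomorphism is a Lie algebra isomorphism that is also an isometry for the given forms. Let $I(X,Y,Z)=B([X,Y],Z)$ be the 3-form associated to $\mathfrak g$ and $\mathrm{dup}(\mathfrak g)=\dim\{\alpha\in\mathfrak g^*\mid\alpha\wedge I=0\}$; a non-Abelian quadratic Lie algebra is singular if $\mathrm{dup}(\mathfrak g)\ge1$. A quadratic Lie algebra structure on $\mathbb C^{n+2}$ is a Lie bracket for which the canonical non-degenerate symmetric bilinear form of $\mathbb C^{n+2}$ is invariant (all non-degenerate symmetric forms on $\mathbb C^{n+2}$ are isometric); here $n\ge2$. *)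

theory Defs
  imports "HOL-Analysis.Analysis" "HOL-Library.Function_Algebras"
begin

locale lie_algebra = vector_space scl
  for scl :: "complex \<Rightarrow> 'a::ab_group_add \<Rightarrow> 'a" +
  fixes bracket :: "'a \<Rightarrow> 'a \<Rightarrow> 'a"
  assumes finite_dim: "\<exists>A. finite A \<and> span A = UNIV"
    and linear_bracket_left: "Vector_Spaces.linear scl scl (\<lambda>x. bracket x y)"
    and linear_bracket_right: "Vector_Spaces.linear scl scl (\<lambda>y. bracket x y)"
    and bracket_self: "bracket x x = 0"
    and jacobi: "bracket x (bracket y z) + bracket y (bracket z x) + bracket z (bracket x y) = 0"
begin

definition abelian :: bool
  where "abelian \<longleftrightarrow> (\<forall>x y. bracket x y = 0)"

primrec derived_series :: "nat \<Rightarrow> 'a set"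
  where "derived_series 0 = UNIV"
  | "derived_series (Suc k) =
      span {bracket x y | x y. x \<in> derived_series k \<and> y \<in> derived_series k}"

definition solvable :: bool
  where "solvable \<longleftrightarrow> (\<exists>k. derived_series k = {0})"

end

text \<open>
  The exterior product of a 1-form and an alternating 3-form, written out over the four
  (1,3)-shuffles; another normalisation of the exterior product would only rescale it by a
  nonzero constant.
\<close>

definition wedge_1_3 ::
    "('a \<Rightarrow> complex) \<Rightarrow> ('a \<Rightarrow> 'a \<Rightarrow> 'a \<Rightarrow> complex) \<Rightarrow> 'a \<Rightarrow> 'a \<Rightarrow> 'a \<Rightarrow> 'a \<Rightarrow> complex"
  where "wedge_1_3 \<alpha> J x y z w =
    \<alpha> x * J y z w - \<alpha> y * J x z w + \<alpha> z * J x y w - \<alpha> w * J x y z"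

locale quadratic_lie_algebra = lie_algebra scl bracket
  for scl :: "complex \<Rightarrow> 'a::ab_group_add \<Rightarrow> 'a"
    and bracket :: "'a \<Rightarrow> 'a \<Rightarrow> 'a" +
  fixes form :: "'a \<Rightarrow> 'a \<Rightarrow> complex"
  assumes linear_form_left: "Vector_Spaces.linear scl (*) (\<lambda>x. form x y)"
    and form_sym: "form x y = form y x"
    and form_nondegenerate: "(\<And>y. form x y = 0) \<Longrightarrow> x = 0"
    and form_invariant: "form (bracket x y) z = form x (bracket y z)"
begin

definition three_form :: "'a \<Rightarrow> 'a \<Rightarrow> 'a \<Rightarrow> complex"
  where "three_form x y z = form (bracket x y) z"

definition dup :: nat
  where "dup = vector_space.dim (\<lambda>c (\<alpha> :: 'a \<Rightarrow> complex) x. c * \<alpha> x)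
    {\<alpha>. Vector_Spaces.linear scl (*) \<alpha> \<and> (\<forall>x y z w. wedge_1_3 \<alpha> three_form x y z w = 0)}"

definition singular :: bool
  where "singular \<longleftrightarrow> \<not> abelian \<and> dup \<ge> 1"

end

locale solvable_singular_quadratic_lie_algebra = quadratic_lie_algebra +
  assumes solvable: solvable
    and singular: singular

definition lie_isomorphism ::
    "(complex \<Rightarrow> 'a::ab_group_add \<Rightarrow> 'a) \<Rightarrow> ('a \<Rightarrow> 'a \<Rightarrow> 'a) \<Rightarrow>
     (complex \<Rightarrow> 'b::ab_group_add \<Rightarrow> 'b) \<Rightarrow> ('b \<Rightarrow> 'b \<Rightarrow> 'b) \<Rightarrow> ('a \<Rightarrow> 'b) \<Rightarrow> bool"
  where "lie_isomorphism scl bracket scl' bracket' f \<longleftrightarrow>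
    Vector_Spaces.linear scl scl' f \<and> bij f \<and>
    (\<forall>x y. f (bracket x y) = bracket' (f x) (f y))"

definition lie_isomorphic ::
    "(complex \<Rightarrow> 'a::ab_group_add \<Rightarrow> 'a) \<Rightarrow> ('a \<Rightarrow> 'a \<Rightarrow> 'a) \<Rightarrow>
     (complex \<Rightarrow> 'b::ab_group_add \<Rightarrow> 'b) \<Rightarrow> ('b \<Rightarrow> 'b \<Rightarrow> 'b) \<Rightarrow> bool"
  where "lie_isomorphic scl bracket scl' bracket' \<longleftrightarrow>
    (\<exists>f. lie_isomorphism scl bracket scl' bracket' f)"

definition i_isomorphic ::
    "(complex \<Rightarrow> 'a::ab_group_add \<Rightarrow> 'a) \<Rightarrow> ('a \<Rightarrow> 'a \<Rightarrow> 'a) \<Rightarrow> ('a \<Rightarrow> 'a \<Rightarrow> complex) \<Rightarrow>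
     (complex \<Rightarrow> 'b::ab_group_add \<Rightarrow> 'b) \<Rightarrow> ('b \<Rightarrow> 'b \<Rightarrow> 'b) \<Rightarrow> ('b \<Rightarrow> 'b \<Rightarrow> complex) \<Rightarrow> bool"
  where "i_isomorphic scl bracket form scl' bracket' form' \<longleftrightarrow>
    (\<exists>f. lie_isomorphism scl bracket scl' bracket' f \<and>
      (\<forall>x y. form' (f x) (f y) = form x y))"

definition canonical_form :: "complex ^ 'm \<Rightarrow> complex ^ 'm \<Rightarrow> complex"
  where "canonical_form x y = (\<Sum>i\<in>UNIV. x $ i * y $ i)"

definition solvable_singular_structures ::
    "(complex ^ 'm \<Rightarrow> complex ^ 'm \<Rightarrow> complex ^ 'm) set"
  where "solvable_singular_structures =
    {bracket. solvable_singular_quadratic_lie_algebra (*s) bracket canonical_form}"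

definition iso_classes :: "(complex ^ 'm \<Rightarrow> complex ^ 'm \<Rightarrow> complex ^ 'm) set set"
  where "iso_classes = solvable_singular_structures //
    {(b, b'). b \<in> solvable_singular_structures \<and> b' \<in> solvable_singular_structures \<and>
      lie_isomorphic (*s) b (*s) b'}"

definition i_iso_classes :: "(complex ^ 'm \<Rightarrow> complex ^ 'm \<Rightarrow> complex ^ 'm) set set"
  where "i_iso_classes = solvable_singular_structures //
    {(b, b'). b \<in> solvable_singular_structures \<and> b' \<in> solvable_singular_structures \<and>
      i_isomorphic (*s) b canonical_form (*s) b' canonical_form}"

end

theory Submission
  imports Defs "HOL-Computational_Algebra.Fundamental_Theorem_Algebra"
begin

text \<open>
  Let \<open>f\<close> be a Lie isomorphism between two solvable singular quadratic Lie algebras. Pulling the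
  second form back along \<open>f\<close> leaves one Lie algebra with two invariant forms \<open>B\<close> and \<open>B2\<close>, and the
  claim becomes that some automorphism carries one form to the other.

  Write \<open>B2(x, y) = B(D x, y)\<close>. Invariance of both forms says that \<open>D [x, y] = [D x, y]\<close>, so \<open>D\<close>
  lies in the centroid. For a general quadratic Lie algebra the centroid may be large, and two
  invariant forms need not be related by an automorphism. Here it is small. Solvability provides a
  central isotropic vector \<open>X\<close> whose dual one-form \<open>\<alpha>\<close> satisfies \<open>\<alpha> \<and> I = 0\<close>
  (\<open>central_wedge_kernel_exists\<close>), and with an isotropic \<open>Y\<close> such that \<open>\<alpha>(Y) = 1\<close> and
  \<open>C = [Y, _]\<close> the bracket is
  \<open>[y, z] = \<alpha>(y) C z - \<alpha>(z) C y + B(C y, z) X\<close>, that is, the algebra is a double extension of an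
  abelian one (\<open>double_extension_bracket\<close>). Inserting this formula into \<open>[x, D x] = 0\<close> shows that
  \<open>D\<close> acts on all brackets by a single scalar \<open>\<mu> \<noteq> 0\<close> (\<open>centroid_scalar\<close>).

  The scalar is absorbed by an automorphism which scales \<open>X\<close>, \<open>Y\<close> and their orthogonal complement
  by \<open>c\<^sup>2\<close>, \<open>1\<close> and \<open>c\<close>; it multiplies \<open>B\<close> by \<open>c\<^sup>2 = \<mu>\<close>. What remains is the symmetric invertible
  map \<open>E = D / \<mu>\<close>, which fixes all brackets. Over the complex numbers \<open>E\<close> has a square root \<open>S\<close> that
  is a polynomial in \<open>E\<close>. Hence \<open>S\<close> is symmetric and, up to sign, fixes all brackets, which makes it
  an automorphism, and \<open>B(S x, S y) = B(E x, y)\<close>. The composition of the two automorphisms is the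
  one required (\<open>isometric_automorphism_exists\<close>).

  Both sets of isomorphism classes are quotients of the same set of brackets, by relations that now
  coincide.
\<close>

section \<open>Square roots of injective endomorphisms\<close>

text \<open>
  The root \<open>a = 0\<close> has to be excluded because \<open>X\<close> is not a square modulo \<open>X\<^sup>2\<close>. Otherwise a
  square root modulo \<open>m1\<close> lifts to one modulo \<open>(X - a) m1\<close> by adding a constant multiple \<open>r m1\<close>
  of \<open>m1\<close>: the condition on \<open>r\<close> is one polynomial equation of degree at most two, and it is
  solvable even when \<open>m1\<close> vanishes at \<open>a\<close>, because then \<open>p(a)\<^sup>2 = a \<noteq> 0\<close> makes it a linear
  equation with nonzero slope. This treats repeated and new roots at once.
\<close>

lemma square_root_modulo_polynomial:
  fixes m :: "complex poly"
  assumes "m \<noteq> 0" and "poly m 0 \<noteq> 0"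
  shows "\<exists>p. m dvd p * p - [:0, 1:]"
  using assms
proof (induction "degree m" arbitrary: m)
  case 0
  then have "is_unit m" by (simp add: is_unit_iff_degree)
  then show ?case by (meson unit_imp_dvd)
next
  case (Suc d)
  have "\<not> constant (poly m)" using Suc.hyps(2) by (simp add: constant_degree)
  then obtain a where a: "poly m a = 0" using fundamental_theorem_of_algebra by blast
  then obtain m1 where m: "m = [:- a, 1:] * m1" by (metis dvdE poly_eq_0_iff_dvd)
  have m1: "m1 \<noteq> 0" using m Suc.prems by auto
  have "degree m = degree [:- a, 1:] + degree m1"
    unfolding m by (rule degree_mult_eq) (use m1 in auto)
  then have deg: "d = degree m1" using Suc.hyps(2) by simp
  have a0: "a \<noteq> 0" using a Suc.prems(2) by auto
  have "poly m1 0 \<noteq> 0" using Suc.prems(2) m by auto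
  then obtain p q where pq: "p * p - [:0, 1:] = m1 * q"
    using Suc.hyps(1)[OF deg m1] by (auto elim: dvdE)
  obtain r where r: "poly q a + 2 * poly p a * r + poly m1 a * r\<^sup>2 = 0"
  proof (cases "poly m1 a = 0")
    case True
    have "poly (p * p - [:0, 1:]) a = 0" unfolding pq using True by simp
    then have "poly p a \<noteq> 0" using a0 by auto
    then show ?thesis using True that[of "- poly q a / (2 * poly p a)"] by simp
  next
    case False
    let ?s = "[:poly q a, 2 * poly p a, poly m1 a:]"
    have "\<not> constant (poly ?s)" using False by (simp add: constant_degree)
    then obtain r where "poly ?s r = 0" using fundamental_theorem_of_algebra by blast
    then show ?thesis using that[of r] by (simp add: algebra_simps power2_eq_square)
  qed
  have "poly (q + 2 * p * [:r:] + m1 * [:r:] * [:r:]) a = 0"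
    using r by (simp add: algebra_simps power2_eq_square)
  then have "[:- a, 1:] dvd q + 2 * p * [:r:] + m1 * [:r:] * [:r:]"
    by (simp only: poly_eq_0_iff_dvd)
  then have "m dvd m1 * (q + 2 * p * [:r:] + m1 * [:r:] * [:r:])"
    unfolding m by (metis dvd_refl mult.commute mult_dvd_mono)
  also have "m1 * (q + 2 * p * [:r:] + m1 * [:r:] * [:r:])
      = m1 * q + (2 * p * m1 * [:r:] + m1 * m1 * [:r:] * [:r:])" by algebra
  also have "\<dots> = (p + m1 * [:r:]) * (p + m1 * [:r:]) - [:0, 1:]"
    unfolding pq[symmetric] by algebra
  finally show ?case by blast
qed

locale linear_endomorphism = vector_space scl
  for scl :: "complex \<Rightarrow> 'a::ab_group_add \<Rightarrow> 'a" +
  fixes T :: "'a \<Rightarrow> 'a"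
  assumes linear_T: "Vector_Spaces.linear scl scl T"
begin

lemma T_add: "T (x + y) = T x + T y" and T_scale: "T (scl c x) = scl c (T x)"
  using linear_T by (auto simp: Vector_Spaces.linear_iff)

lemma T_0: "T 0 = 0"
  using T_scale[of 0] by simp

lemma T_sum: "T (sum f A) = (\<Sum>i\<in>A. T (f i))"
  by (induction A rule: infinite_finite_induct) (auto simp: T_0 T_add)

definition poly_map :: "complex poly \<Rightarrow> 'a \<Rightarrow> 'a"
  where "poly_map p x = (\<Sum>i\<le>degree p. scl (coeff p i) ((T ^^ i) x))"

lemma poly_map_degree_le:
  "degree p \<le> n \<Longrightarrow> poly_map p x = (\<Sum>i\<le>n. scl (coeff p i) ((T ^^ i) x))"
  unfolding poly_map_def by (rule sum.mono_neutral_left) (auto simp: coeff_eq_0)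

lemma poly_map_0: "poly_map 0 x = 0"
  by (simp add: poly_map_def)

lemma poly_map_pCons: "poly_map (pCons a p) x = scl a x + T (poly_map p x)"
proof -
  have "poly_map (pCons a p) x
      = (\<Sum>i\<le>Suc (degree p). scl (coeff (pCons a p) i) ((T ^^ i) x))"
    by (rule poly_map_degree_le) (rule degree_pCons_le)
  also have "\<dots> = scl a x + T (poly_map p x)"
    unfolding sum.atMost_Suc_shift poly_map_def T_sum by (simp add: T_scale)
  finally show ?thesis .
qed

lemma linear_poly_map: "Vector_Spaces.linear scl scl (poly_map p)"
proof (induction p)
  case 0
  then show ?case
    using vector_space_axioms by (auto simp: Vector_Spaces.linear_iff poly_map_0)
next
  case (pCons a p)
  then show ?case
    using vector_space_axioms
    by (auto simp: Vector_Spaces.linear_iff poly_map_pCons T_add T_scale scale_right_distrib scale_left_commute)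
qed

lemma poly_map_add: "poly_map (p + q) x = poly_map p x + poly_map q x"
proof -
  let ?n = "max (degree p) (degree q)"
  show ?thesis
    using poly_map_degree_le[of "p + q" ?n x] poly_map_degree_le[of p ?n x]
      poly_map_degree_le[of q ?n x] degree_add_le_max[of p q]
    by (simp add: sum.distrib scale_left_distrib)
qed

lemma poly_map_smult: "poly_map (smult c p) x = scl c (poly_map p x)"
  using poly_map_degree_le[of "smult c p" "degree p" x] degree_smult_le[of c p]
  by (simp add: poly_map_def scale_sum_right)

lemma poly_map_mult: "poly_map (p * q) x = poly_map p (poly_map q x)"
  by (induction p)
    (simp_all add: poly_map_0 poly_map_pCons poly_map_add poly_map_smult)

lemma poly_map_zero_right: "poly_map p 0 = 0"
  using linear_poly_map[of p] by (metis Vector_Spaces.linear_iff scale_zero_left)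

lemma poly_map_fixed: "T x = x \<Longrightarrow> poly_map p x = scl (poly p 1) x"
  by (induction p) (simp_all add: poly_map_0 poly_map_pCons T_scale scale_left_distrib)

text \<open>
  If no polynomial annihilated \<open>v\<close>, the vectors \<open>v, T v, \<dots>, T\<^sup>n v\<close> would be independent for
  every \<open>n\<close>; taking \<open>n = card A\<close> gives one more vector than a spanning set allows.
\<close>

lemma annihilating_polynomial_vector:
  assumes A: "finite A" "span A = UNIV"
  shows "\<exists>p. p \<noteq> 0 \<and> poly_map p v = 0"
proof (rule ccontr)
  assume "\<not> ?thesis"
  then have nz: "p = 0" if "poly_map p v = 0" for p
    using that by blast
  let ?n = "card A" and ?e = "\<lambda>i. (T ^^ i) v"
  have e: "?e i = poly_map (monom 1 i) v" for i
  proof -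
    have "poly_map (monom 1 i) v = (\<Sum>j\<le>i. if j = i then ?e j else 0)"
      unfolding poly_map_def by (rule sum.cong) (auto simp: degree_monom_eq)
    also have "\<dots> = ?e i" by simp
    finally show ?thesis ..
  qed
  have inj: "inj ?e"
  proof (rule injI)
    fix i j assume "?e i = ?e j"
    then have "poly_map (monom 1 i + smult (- 1) (monom 1 j)) v = 0"
      by (simp only: poly_map_add poly_map_smult flip: e) simp
    then have "monom 1 i = (monom 1 j :: complex poly)"
      using nz by fastforce
    then show "i = j" by (metis degree_monom_eq one_neq_zero)
  qed
  have "independent (?e ` {..?n})"
  proof (rule independent_if_scalars_zero)
    fix u x assume u: "(\<Sum>x\<in>?e ` {..?n}. scl (u x) x) = 0" and x: "x \<in> ?e ` {..?n}"
    let ?p = "\<Sum>i\<le>?n. monom (u (?e i)) i"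
    have cf: "coeff ?p i = (if i \<le> ?n then u (?e i) else 0)" for i
      by (simp add: coeff_sum)
    then have "degree ?p \<le> ?n" by (intro degree_le) simp
    then have "poly_map ?p v = (\<Sum>i\<le>?n. scl (u (?e i)) (?e i))"
      using poly_map_degree_le[of ?p ?n v] cf by simp
    also have "\<dots> = 0"
      using u inj by (subst (asm) sum.reindex) (auto intro: inj_on_subset)
    finally have "?p = 0" by (rule nz)
    moreover obtain i where "x = ?e i" "i \<le> ?n" using x by blast
    ultimately show "u x = 0" using cf[of i] by simp
  qed simp
  then have "card (?e ` {..?n}) \<le> card A"
    using independent_span_bound[of A "?e ` {..?n}"] A by simp
  moreover have "card (?e ` {..?n}) = Suc ?n"
    using card_image[of ?e "{..?n}"] inj by (auto intro: inj_on_subset)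
  ultimately show False by simp
qed

lemma annihilating_polynomial:
  assumes A: "finite A" "span A = UNIV"
  shows "\<exists>p. p \<noteq> 0 \<and> (\<forall>x. poly_map p x = 0)"
proof -
  obtain P where P: "P v \<noteq> 0" "poly_map (P v) v = 0" for v
    using annihilating_polynomial_vector[OF A] by metis
  let ?p = "\<Prod>v\<in>A. P v"
  have "poly_map ?p v = 0" if "v \<in> A" for v
  proof -
    have "?p = (\<Prod>w\<in>A - {v}. P w) * P v"
      using A that by (simp add: prod.remove mult.commute)
    then show ?thesis by (simp add: poly_map_mult P poly_map_zero_right)
  qed
  moreover have "vector_space_pair scl scl"
    using vector_space_axioms by (simp add: vector_space_pair_def)
  ultimately have "poly_map ?p x = 0" for x
    using vector_space_pair.linear_eq_0_on_span[OF _ linear_poly_map, of A ?p x] A by auto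
  moreover have "?p \<noteq> 0" using P A by simp
  ultimately show ?thesis by blast
qed

text \<open>
  An annihilating polynomial \<open>m\<close> of least degree has nonzero constant term because \<open>T\<close> is
  injective, so that \<open>X\<close> has a square root modulo \<open>m\<close>. That the root is a polynomial in \<open>T\<close> is
  the point: it inherits the symmetries and the fixed vectors of \<open>T\<close>.
\<close>

lemma square_root_exists:
  assumes A: "finite A" "span A = UNIV" and inj: "inj T"
  shows "\<exists>p. \<forall>x. poly_map p (poly_map p x) = T x"
proof -
  let ?Q = "\<lambda>p. p \<noteq> 0 \<and> (\<forall>x. poly_map p x = 0)"
  obtain m where m: "?Q m" and min: "\<And>q. ?Q q \<Longrightarrow> degree m \<le> degree q"
    using annihilating_polynomial[OF A] ex_has_least_nat[of ?Q _ degree] by blast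
  have "poly m 0 \<noteq> 0"
  proof
    assume "poly m 0 = 0"
    then obtain q where q: "m = pCons 0 q" by (cases m) auto
    have "T (poly_map q x) = T 0" for x
      using m unfolding q poly_map_pCons by (simp add: T_0)
    then have "?Q q" using m q inj by (auto dest: injD)
    then show False using min[of q] q by simp
  qed
  then obtain p r where pr: "p * p - [:0, 1:] = m * r"
    using square_root_modulo_polynomial[of m] m by (auto elim: dvdE)
  have "poly_map (p * p) x = T x" for x
  proof -
    have "p * p = [:0, 1:] + m * r" using pr by (simp add: algebra_simps)
    then have "poly_map (p * p) x = poly_map [:0, 1:] x"
      using m by (simp add: poly_map_add poly_map_mult)
    then show ?thesis by (simp add: poly_map_pCons poly_map_0 T_0)
  qed
  then show ?thesis by (auto simp: poly_map_mult)
qed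

end

section \<open>Lie algebras and invariant forms\<close>

context lie_algebra
begin

lemma bracket_add_left: "bracket (x + y) z = bracket x z + bracket y z"
  and bracket_scale_left: "bracket (scl c x) z = scl c (bracket x z)"
  and bracket_add_right: "bracket z (x + y) = bracket z x + bracket z y"
  and bracket_scale_right: "bracket z (scl c x) = scl c (bracket z x)"
  using linear_bracket_left[of z] linear_bracket_right[of z]
  unfolding Vector_Spaces.linear_iff by simp_all

lemma bracket_zero_left: "bracket 0 z = 0" and bracket_zero_right: "bracket z 0 = 0"
  using bracket_scale_left[of 0 0 z] bracket_scale_right[of z 0 0] by simp_all

lemma bracket_minus_left: "bracket (- x) z = - bracket x z"
  and bracket_minus_right: "bracket z (- x) = - bracket z x"
  using bracket_scale_left[of "- 1" x z] bracket_scale_right[of z "- 1" x] by simp_all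

lemma bracket_diff_left: "bracket (x - y) z = bracket x z - bracket y z"
  and bracket_diff_right: "bracket z (x - y) = bracket z x - bracket z y"
  using bracket_add_left[of x "- y" z] bracket_add_right[of z x "- y"]
  by (simp_all add: bracket_minus_left bracket_minus_right)

lemmas bracket_simps = bracket_add_left bracket_add_right bracket_scale_left bracket_scale_right
  bracket_zero_left bracket_zero_right bracket_minus_left bracket_minus_right
  bracket_diff_left bracket_diff_right bracket_self

lemma bracket_skew: "bracket x y = - bracket y x"
proof -
  have "bracket x y + bracket y x = bracket x (x + y) + bracket y (x + y)"
    by (simp add: bracket_add_right bracket_self)
  also have "\<dots> = bracket (x + y) (x + y)"
    by (simp only: bracket_add_left)
  finally have "bracket x y + bracket y x = bracket (x + y) (x + y)" .
  then show ?thesis by (simp only: bracket_self eq_neg_iff_add_eq_0)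
qed

lemma bracket_derivation: "bracket u (bracket x y) = bracket (bracket u x) y + bracket x (bracket u y)"
proof -
  have "bracket y (bracket u x) = - bracket (bracket u x) y"
    and "bracket x (bracket y u) = - bracket x (bracket u y)"
    using bracket_skew[of y "bracket u x"] bracket_skew[of y u] by (simp_all add: bracket_minus_right)
  then have "bracket u (bracket x y) - bracket x (bracket u y) - bracket (bracket u x) y = 0"
    using jacobi[of u x y] by simp
  then show ?thesis by (simp add: algebra_simps)
qed

lemma bracket_derived_series: "x \<in> derived_series k \<Longrightarrow> bracket u x \<in> derived_series k"
proof (induction k arbitrary: u x)
  case 0
  then show ?case by simp
next
  case (Suc k)
  let ?S = "{bracket x y | x y. x \<in> derived_series k \<and> y \<in> derived_series k}"
  have "x \<in> span ?S" using Suc.prems by simp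
  then have "bracket u x \<in> span ?S"
  proof (induction x rule: span_induct_alt)
    case base
    then show ?case by (simp add: bracket_simps span_zero)
  next
    case (step c x y)
    then obtain a b where ab: "x = bracket a b" "a \<in> derived_series k" "b \<in> derived_series k"
      by blast
    then have "bracket (bracket u a) b \<in> ?S" "bracket a (bracket u b) \<in> ?S"
      using Suc.IH[OF ab(2), of u] Suc.IH[OF ab(3), of u] ab(2,3) by blast+
    then have "bracket u x \<in> span ?S"
      unfolding ab(1) bracket_derivation[of u a b] by (intro span_add span_base)
    then show ?case using step(2)
      unfolding bracket_add_right bracket_scale_right by (intro span_add span_scale)
  qed
  then show ?case by simp
qed

lemma finite_dimensional: "\<exists>Basis. finite_dimensional_vector_space scl Basis"
proof -
  obtain A where A: "finite A" "span A = UNIV" using finite_dim by blast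
  obtain Ba where Ba: "independent Ba" "span Ba = UNIV"
    using maximal_independent_subset[of UNIV] by (metis UNIV_eq_I subsetD UNIV_I)
  then have "finite Ba" using independent_span_bound[of A Ba] A by simp
  then have "finite_dimensional_vector_space scl Ba"
    using Ba by unfold_locales
  then show ?thesis ..
qed

end

context quadratic_lie_algebra
begin

lemma form_add_left: "form (x + y) z = form x z + form y z"
  and form_scale_left: "form (scl c x) z = c * form x z"
  using linear_form_left[of z] unfolding Vector_Spaces.linear_iff by simp_all

lemma form_add_right: "form z (x + y) = form z x + form z y"
  and form_scale_right: "form z (scl c x) = c * form z x"
  by (simp_all only: form_sym[of z] form_add_left form_scale_left)

lemma form_zero_left: "form 0 z = 0" and form_zero_right: "form z 0 = 0"
  using form_scale_left[of 0 0 z] form_scale_right[of z 0 0] by simp_all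

lemma form_minus_left: "form (- x) z = - form x z"
  and form_minus_right: "form z (- x) = - form z x"
  using form_scale_left[of "- 1" x z] form_scale_right[of z "- 1" x] by simp_all

lemma form_diff_left: "form (x - y) z = form x z - form y z"
  and form_diff_right: "form z (x - y) = form z x - form z y"
  using form_add_left[of x "- y" z] form_add_right[of z x "- y"]
  by (simp_all add: form_minus_left form_minus_right)

lemmas form_simps = form_add_left form_add_right form_scale_left form_scale_right
  form_zero_left form_zero_right form_minus_left form_minus_right form_diff_left form_diff_right

lemma form_eqI: "(\<And>z. form x z = form y z) \<Longrightarrow> x = y"
  using form_nondegenerate[of "x - y"] by (simp add: form_simps)

lemma form_bracket_skew: "form (bracket u x) y = - form x (bracket u y)"
  using bracket_skew[of u x] form_invariant[of x u y] by (simp add: form_simps)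

text \<open>
  The coordinates \<open>form x b\<close> over a basis determine \<open>x\<close>, so sending \<open>x\<close> to the vector with these
  coordinates is an injective, hence surjective, endomorphism. Using an endomorphism in place of
  the map into the dual avoids comparing the dimensions of two spaces.
\<close>

lemma form_represents:
  assumes \<phi>: "Vector_Spaces.linear scl (*) \<phi>"
  shows "\<exists>x. \<forall>y. form x y = \<phi> y"
proof -
  obtain Ba where "finite_dimensional_vector_space scl Ba" using finite_dimensional ..
  then interpret V: finite_dimensional_vector_space scl Ba .
  have eq_on_span: "f = g" if "Vector_Spaces.linear scl (*) f" "Vector_Spaces.linear scl (*) g"
    "\<And>b. b \<in> Ba \<Longrightarrow> f b = g b" for f g :: "'a \<Rightarrow> complex"
  proof -
    interpret P: vector_space_pair scl "(*) :: complex \<Rightarrow> _"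
      using that(1) by (simp add: vector_space_pair_def Vector_Spaces.linear_iff)
    have "f x = g x" for x
      using P.linear_eq_on_span[OF that(1,2) that(3), of Ba x] V.span_Basis by auto
    then show ?thesis by blast
  qed
  have lin: "Vector_Spaces.linear scl (*) (form x)" for x
    using linear_form_left[of x] by (simp only: form_sym[of _ x])
  define h where "h x = (\<Sum>b\<in>Ba. scl (form x b) b)" for x
  have h: "Vector_Spaces.linear scl scl h"
    unfolding Vector_Spaces.linear_iff h_def form_add_left form_scale_left
    by (intro conjI allI vector_space_axioms)
      (simp_all add: scale_left_distrib sum.distrib scale_sum_right)
  have coeffs: "f b = g b" if eq: "(\<Sum>b\<in>Ba. scl (f b) b) = (\<Sum>b\<in>Ba. scl (g b) b)" and b: "b \<in> Ba" for f g b
  proof -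
    have "(\<Sum>b\<in>Ba. scl (f b - g b) b) = 0"
      by (simp only: scale_left_diff_distrib sum_subtractf eq) simp
    then have "f b - g b = 0"
      by (rule independentD[OF V.independent_Basis V.finite_Basis subset_refl _ b])
    then show ?thesis by simp
  qed
  have "inj h"
  proof (rule injI)
    fix x y assume "h x = h y"
    then have "form x b = form y b" if "b \<in> Ba" for b
      using coeffs[of "form x" "form y" b] that by (simp only: h_def)
    then have "form x = form y" by (rule eq_on_span[OF lin lin])
    then show "x = y" by (auto intro: form_eqI)
  qed
  then have "surj h" by (rule V.linear_inj_imp_surj[OF h])
  then obtain x where "h x = (\<Sum>b\<in>Ba. scl (\<phi> b) b)" by (metis surjD)
  then have "form x b = \<phi> b" if "b \<in> Ba" for b
    using coeffs[of "form x" \<phi> b] that by (simp only: h_def)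
  then have "form x = \<phi>" by (rule eq_on_span[OF lin \<phi>])
  then show ?thesis by auto
qed

section \<open>The one-forms annihilating the associated three-form\<close>

text \<open>
  The vectors which correspond, under the form, to the one-forms \<open>\<alpha>\<close> with \<open>\<alpha> \<and> I = 0\<close>, so that
  \<open>dup\<close> is the dimension of this subspace.
\<close>

definition wedge_kernel :: "'a set"
  where "wedge_kernel = {X. \<forall>x y z w. wedge_1_3 (form X) three_form x y z w = 0}"

lemma wedge_kernelD:
  "X \<in> wedge_kernel \<Longrightarrow> form X x * form (bracket y z) w - form X y * form (bracket x z) w
    + form X z * form (bracket x y) w - form X w * form (bracket x y) z = 0"
  by (simp add: wedge_kernel_def wedge_1_3_def three_form_def)

lemma wedge_kernel_nonzero:
  assumes singular
  shows "\<exists>X\<in>wedge_kernel. X \<noteq> 0"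
proof (rule ccontr)
  assume none: "\<not> ?thesis"
  let ?K = "{\<alpha>. Vector_Spaces.linear scl (*) \<alpha> \<and> (\<forall>x y z w. wedge_1_3 \<alpha> three_form x y z w = 0)}"
  have K: "?K \<subseteq> {0}"
  proof clarify
    fix \<alpha> :: "'a \<Rightarrow> complex"
    assume \<alpha>: "Vector_Spaces.linear scl (*) \<alpha>" "\<forall>x y z w. wedge_1_3 \<alpha> three_form x y z w = 0"
    obtain X where "form X = \<alpha>" using form_represents[OF \<alpha>(1)] by blast
    then have "X \<in> wedge_kernel" using \<alpha>(2) by (simp add: wedge_kernel_def)
    then have "X = 0" using none by blast
    then show "\<alpha> = 0" using \<open>form X = \<alpha>\<close> by (auto simp: form_simps fun_eq_iff)
  qed
  interpret F: vector_space "\<lambda>c (\<alpha> :: 'a \<Rightarrow> complex) x. c * \<alpha> x"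
    by unfold_locales (auto simp: fun_eq_iff algebra_simps)
  have "F.dim ?K \<le> card ({} :: ('a \<Rightarrow> complex) set)"
    by (rule F.dim_le_card) (use K in auto)
  then have "dup = 0" unfolding dup_def by simp
  then show False using assms by (simp add: singular_def)
qed

lemma wedge_kernel_diff: "X \<in> wedge_kernel \<Longrightarrow> Y \<in> wedge_kernel \<Longrightarrow> X - scl c Y \<in> wedge_kernel"
proof -
  assume "X \<in> wedge_kernel" "Y \<in> wedge_kernel"
  then have "wedge_1_3 (form (X - scl c Y)) three_form x y z w = 0" for x y z w
    using wedge_kernelD[of X x y z w] wedge_kernelD[of Y x y z w]
    unfolding wedge_1_3_def three_form_def form_simps by algebra
  then show ?thesis by (simp add: wedge_kernel_def)
qed

text \<open>
  Because the form is invariant, inner derivations annihilate the three-form \<open>I\<close>. Applying such a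
  derivation to the equation \<open>\<alpha> \<and> I = 0\<close> therefore moves it onto \<open>\<alpha>\<close> alone, and the kernel is
  an ideal.
\<close>

lemma wedge_kernel_bracket:
  assumes X: "X \<in> wedge_kernel"
  shows "bracket u X \<in> wedge_kernel"
proof -
  note D = wedge_kernelD[OF X]
  have inv: "form (bracket (bracket u x) y) z + form (bracket x (bracket u y)) z
      + form (bracket x y) (bracket u z) = 0" for x y z
    using form_bracket_skew[of u "bracket x y" z] bracket_derivation[of u x y]
    by (simp add: form_simps)
  have "wedge_1_3 (form (bracket u X)) three_form x y z w = 0" for x y z w
    unfolding wedge_1_3_def three_form_def form_bracket_skew[of u X]
    using D[of "bracket u x" y z w] D[of x "bracket u y" z w] D[of x y "bracket u z" w]
      D[of x y z "bracket u w"] inv[of y z w] inv[of x z w] inv[of x y w] inv[of x y z]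
    by algebra
  then show ?thesis by (simp add: wedge_kernel_def)
qed

text \<open>
  Contracting \<open>\<alpha> \<and> I = 0\<close> with a vector \<open>Y\<close> on which \<open>\<alpha> = form X\<close> takes the value one
  gives \<open>I = \<alpha> \<and> \<Omega>\<close> with \<open>\<Omega>(y, z) = form (bracket Y y) z\<close>. The formula is this identity
  translated back to brackets: the skew map \<open>bracket Y\<close> determines the whole algebra.
\<close>

lemma double_extension_bracket:
  assumes X: "X \<in> wedge_kernel" and Y: "form X Y = 1"
  shows "bracket y z = scl (form X y) (bracket Y z) - scl (form X z) (bracket Y y)
    + scl (form (bracket Y y) z) X"
proof (rule form_eqI)
  fix w
  show "form (bracket y z) w = form (scl (form X y) (bracket Y z) - scl (form X z) (bracket Y y)
    + scl (form (bracket Y y) z) X) w"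
    using wedge_kernelD[OF X, of Y y z w] Y unfolding form_simps by algebra
qed

lemma dual_vector_exists:
  assumes "X \<noteq> 0"
  shows "\<exists>Y. form X Y = 1"
proof -
  obtain y where "form X y \<noteq> 0" using form_nondegenerate assms by blast
  then have "form X (scl (1 / form X y) y) = 1" by (simp add: form_simps)
  then show ?thesis ..
qed

section \<open>A central vector dual to an annihilating one-form\<close>

text \<open>
  If \<open>V = 0\<close>, the bracket formula makes \<open>X\<close> central. If not, the Jacobi identity for \<open>V\<close> and two
  vectors orthogonal to \<open>X\<close> forces \<open>bracket Y V\<close> to be a multiple \<open>c V\<close> of \<open>V\<close>. Then
  \<open>bracket Y\<close> kills \<open>V - c X\<close>, which is orthogonal to \<open>X\<close>, and the bracket formula makes this
  vector central. The hypotheses on \<open>V\<close> exclude \<open>sl\<^sub>2\<close>, where an isotropic \<open>X\<close> has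
  \<open>form V V \<noteq> 0\<close>.
\<close>

lemma isotropic_imp_central_exists:
  assumes X: "X \<in> wedge_kernel" "X \<noteq> 0" and isotropic: "form X X = 0"
    and Y: "form X Y = 1" and V_def: "V = bracket Y X" and V: "form V V = 0" "bracket X V = 0"
  shows "\<exists>Z\<in>wedge_kernel. Z \<noteq> 0 \<and> (\<forall>z. bracket Z z = 0)"
proof (cases "V = 0")
  case True
  then have "bracket X z = 0" for z
    using double_extension_bracket[OF X(1) Y, of X z] isotropic V_def
    by (simp add: form_simps)
  then show ?thesis using X by blast
next
  case False
  have XV: "form X V = 0"
    using form_bracket_skew[of Y X X] form_sym[of X V] V_def by simp
  have YV: "form V Y = 0"
    unfolding V_def form_bracket_skew by (simp add: bracket_self form_simps)
  have X_br: "bracket X z = scl (form V z) X - scl (form X z) V" for z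
    using double_extension_bracket[OF X(1) Y, of X z] isotropic V_def by simp
  let ?W = "bracket Y V"
  have YW: "form ?W Y = 0"
    unfolding form_bracket_skew by (simp add: bracket_self form_simps)
  have V_br: "bracket V z = scl (form ?W z) X - scl (form X z) ?W" for z
    using double_extension_bracket[OF X(1) Y, of V z] XV by simp
  \<comment> \<open>All three terms of the Jacobi identity for \<open>V, z, w\<close> are multiples of \<open>X\<close>.\<close>
  have proportional: "form ?W z * form V w = form ?W w * form V z"
    if "form X z = 0" "form X w = 0" for z w
  proof -
    have "bracket z w = scl (form (bracket Y z) w) X"
      using double_extension_bracket[OF X(1) Y, of z w] that by simp
    then have "bracket V (bracket z w) = 0"
      using V(2) bracket_skew[of V X] by (simp add: bracket_simps)
    moreover have "bracket z (bracket w V) = scl (form ?W w * form V z) X"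
      using bracket_skew[of w V] bracket_skew[of z X] that
      by (simp add: V_br X_br bracket_simps)
    moreover have "bracket w (bracket V z) = - scl (form ?W z * form V w) X"
      using bracket_skew[of w X] that
      by (simp add: V_br X_br bracket_simps)
    ultimately have "scl (form ?W w * form V z - form ?W z * form V w) X = 0"
      using jacobi[of V z w] by (simp add: scale_left_diff_distrib)
    then show ?thesis using X(2) by simp
  qed
  obtain w' where w': "form V w' \<noteq> 0" using form_nondegenerate False by blast
  \<comment> \<open>Subtracting a multiple of \<open>Y\<close> moves \<open>w'\<close> into the orthogonal complement of \<open>X\<close> without
    changing \<open>form V w'\<close>.\<close>
  define w where "w = w' - scl (form X w') Y"
  have w: "form V w \<noteq> 0" "form X w = 0" using w' YV Y by (auto simp: w_def form_simps)
  define c where "c = form ?W w / form V w"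
  have W: "?W = scl c V"
  proof (rule form_eqI)
    fix z
    let ?z = "z - scl (form X z) Y"
    have "form ?W ?z * form V w = form ?W w * form V ?z"
      using proportional[of ?z w] w Y by (simp add: form_simps)
    then have "form ?W z * form V w = form ?W w * form V z"
      using YV YW by (simp add: form_simps)
    then show "form ?W z = form (scl c V) z"
      using w by (simp add: c_def form_simps field_simps)
  qed
  let ?Z = "V - scl c X"
  have "bracket ?Z z = 0" for z
    unfolding bracket_simps V_br X_br W by (simp add: form_simps algebra_simps)
  moreover have "?Z \<noteq> 0"
  proof
    assume "?Z = 0"
    then have "form V Y = c" using Y by (simp add: form_simps)
    then show False using \<open>?Z = 0\<close> YV False by simp
  qed
  moreover have "?Z \<in> wedge_kernel"
    using wedge_kernel_diff wedge_kernel_bracket X(1) unfolding V_def by blast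
  ultimately show ?thesis by blast
qed

text \<open>
  Solvability enters here only: the last term of the derived series which meets the kernel
  nontrivially meets it in an ideal whose own brackets lie in the next term, and so vanish.
\<close>

lemma abelian_ideal_exists:
  assumes solvable singular
  shows "\<exists>A\<subseteq>wedge_kernel. (\<exists>X\<in>A. X \<noteq> 0) \<and> (\<forall>u. \<forall>X\<in>A. bracket u X \<in> A)
    \<and> (\<forall>X\<in>A. \<forall>X'\<in>A. bracket X X' = 0)"
proof -
  let ?A = "\<lambda>k. wedge_kernel \<inter> derived_series k"
  let ?P = "\<lambda>k. \<forall>X\<in>?A k. X = 0"
  obtain k where "derived_series k = {0}" using assms(1) by (auto simp: solvable_def)
  then have Pk: "?P k" by simp
  have P0: "\<not> ?P 0" using wedge_kernel_nonzero[OF assms(2)] by auto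
  have "\<exists>k. \<not> ?P k \<and> ?P (Suc k)"
  proof (rule ccontr)
    assume "\<not> ?thesis"
    then have "\<not> ?P k" for k using P0 by (induction k) blast+
    then show False using Pk by blast
  qed
  then obtain k where k: "\<not> ?P k" "?P (Suc k)" by blast
  show ?thesis
  proof (intro exI[of _ "?A k"] conjI allI ballI)
    show "?A k \<subseteq> wedge_kernel" and "\<exists>X\<in>?A k. X \<noteq> 0" using k by auto
    show "bracket u X \<in> ?A k" if "X \<in> ?A k" for u X
      using that wedge_kernel_bracket bracket_derived_series by simp
    show "bracket X X' = 0" if "X \<in> ?A k" "X' \<in> ?A k" for X X'
    proof -
      have "bracket X X' \<in> derived_series (Suc k)"
        using that by (auto intro!: span_base)
      moreover have "bracket X X' \<in> wedge_kernel" using that wedge_kernel_bracket by blast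
      ultimately show ?thesis using k(2) by blast
    qed
  qed
qed

text \<open>
  In an abelian ideal \<open>A\<close> invariance makes every \<open>bracket u Z\<close> with \<open>Z\<close> in \<open>A\<close> isotropic. So
  either the first vector chosen is central already, or bracketing it with some \<open>y\<close> gives an
  isotropic vector to which the preceding lemma applies.
\<close>

lemma central_wedge_kernel_exists:
  assumes solvable singular
  shows "\<exists>X\<in>wedge_kernel. X \<noteq> 0 \<and> (\<forall>z. bracket X z = 0)"
proof -
  obtain A where A: "A \<subseteq> wedge_kernel" "\<exists>X\<in>A. X \<noteq> 0"
    and ideal_all: "\<forall>u. \<forall>X\<in>A. bracket u X \<in> A"
    and ab_all: "\<forall>X\<in>A. \<forall>X'\<in>A. bracket X X' = 0"
    using abelian_ideal_exists[OF assms] by (elim exE conjE)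
  have ideal: "bracket u Z \<in> A" if "Z \<in> A" for u Z
    using ideal_all that by simp
  have ab: "bracket Z Z' = 0" if "Z \<in> A" "Z' \<in> A" for Z Z'
    using ab_all that by simp
  obtain X0 where X0: "X0 \<in> A" "X0 \<noteq> 0" using A(2) by blast
  show ?thesis
  proof (cases "\<forall>z. bracket X0 z = 0")
    case True
    then show ?thesis using X0 A(1) by blast
  next
    case False
    then obtain y where "bracket X0 y \<noteq> 0" by blast
    then have X: "bracket y X0 \<noteq> 0" using bracket_skew[of y X0] by simp
    let ?X = "bracket y X0"
    have XA: "?X \<in> A" by (rule ideal[OF X0(1)])
    obtain Y where Y: "form ?X Y = 1" using dual_vector_exists[OF X] by blast
    have VA: "bracket Y ?X \<in> A" by (rule ideal[OF XA])
    have square: "form (bracket u Z) (bracket u Z) = 0" if "Z \<in> A" for u Z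
      using form_invariant[of u Z "bracket u Z"] ab[OF that ideal[OF that]] by (simp add: form_simps)
    show ?thesis
      by (rule isotropic_imp_central_exists[OF subsetD[OF A(1) XA] X square[OF X0(1)] Y refl
            square[OF XA] ab[OF XA VA]])
  qed
qed

end

section \<open>Solvable singular algebras as double extensions\<close>

text \<open>
  The normal form of a solvable singular algebra: it is spanned by a hyperbolic pair \<open>X, Y\<close> and
  the orthogonal complement of this pair, with \<open>X\<close> central, \<open>Y\<close> acting on the complement by a
  skew map \<open>C\<close>, and \<open>[y, z] = form (C y) z X\<close> for \<open>y\<close>, \<open>z\<close> in the complement.
\<close>

locale double_extension = quadratic_lie_algebra +
  fixes X Y
  assumes nonabelian: "\<not> abelian"
    and X_kernel: "X \<in> wedge_kernel"
    and X_central: "bracket X z = 0"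
    and form_XX: "form X X = 0" and form_YY: "form Y Y = 0" and form_XY: "form X Y = 1"

lemma (in quadratic_lie_algebra) double_extension_exists:
  assumes solvable singular
  shows "\<exists>X Y. double_extension scl bracket form X Y"
proof -
  obtain X where X: "X \<in> wedge_kernel" "X \<noteq> 0" and central: "\<And>z. bracket X z = 0"
    using central_wedge_kernel_exists[OF assms] by blast
  obtain Y where Y: "form X Y = 1" using dual_vector_exists[OF X(2)] by blast
  have nonab: "\<not> abelian" using assms(2) by (simp add: singular_def)
  \<comment> \<open>If \<open>X\<close> were not isotropic, a multiple of the central \<open>X\<close> could serve as \<open>Y\<close> in the bracket
    formula, and all brackets would vanish.\<close>
  have XX: "form X X = 0"
  proof (rule ccontr)
    assume "form X X \<noteq> 0"
    let ?Y = "scl (1 / form X X) X"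
    have "form X ?Y = 1" using \<open>form X X \<noteq> 0\<close> by (simp add: form_simps)
    then have "bracket y z = 0" for y z
      using double_extension_bracket[OF X(1), of ?Y y z] by (simp add: bracket_simps central form_simps)
    then show False using nonab by (simp add: abelian_def)
  qed
  \<comment> \<open>This correction makes \<open>Y\<close> isotropic and keeps \<open>form X Y = 1\<close>.\<close>
  let ?Y = "Y - scl (form Y Y / 2) X"
  have "double_extension scl bracket form X ?Y"
    by unfold_locales (use nonab X central XX Y form_sym[of Y X] in \<open>simp_all add: form_simps\<close>)
  then show ?thesis by blast
qed

context double_extension
begin

lemma X_central_right: "bracket z X = 0"
  using bracket_skew[of z X] X_central by simp

lemma form_X_bracket: "form X (bracket u z) = 0" "form (bracket u z) X = 0"
  using form_bracket_skew[of u z X] X_central_right form_sym[of X] by (simp_all add: form_simps)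

lemma form_Y_bracket: "form (bracket Y z) Y = 0"
  using form_bracket_skew[of Y z Y] by (simp add: form_simps bracket_self)

lemma bracket_formula:
  "bracket y z = scl (form X y) (bracket Y z) - scl (form X z) (bracket Y y)
    + scl (form (bracket Y y) z) X"
  by (rule double_extension_bracket[OF X_kernel form_XY])

lemma ad_Y_nonzero_on_kernel: "\<exists>x. form X x = 0 \<and> bracket Y x \<noteq> 0"
proof (rule ccontr)
  assume none: "\<not> ?thesis"
  have "bracket Y x = 0" for x
  proof -
    have "form X (x - scl (form X x) Y) = 0" by (simp add: form_simps form_XY)
    then have "bracket Y (x - scl (form X x) Y) = 0" using none by blast
    then show ?thesis by (simp add: bracket_simps)
  qed
  then have "bracket y z = 0" for y z
    using bracket_formula[of y z] by (simp add: form_simps)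
  then show False using nonabelian by (simp add: abelian_def)
qed

text \<open>
  A map \<open>D\<close> in the centroid satisfies \<open>[x, D x] = D [x, x] = 0\<close>. Writing this out with the
  bracket formula gives \<open>\<alpha>(x) C D x = \<alpha>(D x) C x\<close>, where \<open>\<alpha> = form X\<close> and \<open>C = bracket Y\<close>.
  On the kernel of \<open>\<alpha>\<close> it yields \<open>\<alpha> (D x) = 0\<close> wherever \<open>C x \<noteq> 0\<close>; off the kernel it
  yields \<open>C D x = \<mu> C x\<close>. Both conditions hold on the complement of a proper subspace, and such a
  complement spans, so \<open>\<alpha> \<circ> D = \<mu> \<alpha>\<close> and \<open>C \<circ> D = \<mu> C\<close> everywhere.
\<close>

lemma centroid_scalar:
  assumes D: "Vector_Spaces.linear scl scl D"
    and left: "\<And>x y. D (bracket x y) = bracket (D x) y"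
  shows "\<exists>\<mu>. \<forall>x y. D (bracket x y) = scl \<mu> (bracket x y)"
proof -
  have D_add: "D (x + y) = D x + D y" and D_scale: "D (scl c x) = scl c (D x)" for x y c
    using D by (simp_all add: Vector_Spaces.linear_iff)
  have D0: "D 0 = 0" using D_scale[of 0] by simp
  have "bracket (D x) x = 0" for x using left[of x x] D0 by (simp add: bracket_self)
  then have "bracket x (D x) = 0" for x using bracket_skew[of x "D x"] by simp
  then have zero: "scl (form X x) (bracket Y (D x)) - scl (form X (D x)) (bracket Y x)
      + scl (form (bracket Y x) (D x)) X = 0" for x
    using bracket_formula[of x "D x"] by simp
  \<comment> \<open>Pairing with \<open>Y\<close> isolates the component along \<open>X\<close>.\<close>
  have "form (bracket Y x) (D x) = 0" for x
  proof -
    have "form (scl (form X x) (bracket Y (D x)) - scl (form X (D x)) (bracket Y x)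
      + scl (form (bracket Y x) (D x)) X) Y = 0"
      unfolding zero by (simp add: form_simps)
    then show ?thesis by (simp add: form_simps form_Y_bracket form_XY)
  qed
  then have key: "scl (form X x) (bracket Y (D x)) = scl (form X (D x)) (bracket Y x)" for x
    using zero[of x] by simp
  have moved: "form X (D x) = 0" if "form X x = 0" "bracket Y x \<noteq> 0" for x
    using key[of x] that by simp
  obtain x0 where x0: "form X x0 = 0" "bracket Y x0 \<noteq> 0" using ad_Y_nonzero_on_kernel by blast
  have kernel: "form X (D x) = 0" if "form X x = 0" for x
  proof (cases "bracket Y x = 0")
    case True
    then have "form X (D (x + x0)) = 0"
      using moved[of "x + x0"] that x0 by (simp add: form_simps bracket_simps)
    then show ?thesis using moved[of x0] x0 by (simp add: D_add form_simps)
  qed (use moved that in blast)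
  define \<mu> where "\<mu> = form X (D Y)"
  have XD: "form X (D x) = \<mu> * form X x" for x
  proof -
    have "form X (D (x + scl (- form X x) Y)) = 0"
      by (rule kernel) (simp add: form_simps form_XY)
    then show ?thesis unfolding D_add D_scale form_add_right form_scale_right \<mu>_def by simp
  qed
  have off: "bracket Y (D x) = scl \<mu> (bracket Y x)" if "form X x \<noteq> 0" for x
  proof -
    have "scl (form X x) (bracket Y (D x)) = scl (form X x) (scl \<mu> (bracket Y x))"
      using key[of x] XD[of x] by (simp add: mult.commute)
    then show ?thesis using that scale_left_imp_eq by blast
  qed
  have YD: "bracket Y (D x) = scl \<mu> (bracket Y x)" for x
  proof (cases "form X x = 0")
    case True
    then show ?thesis
      using off[of "x + Y"] off[of Y] form_XY
      by (simp add: D_add form_simps bracket_simps scale_right_distrib)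
  qed (rule off)
  have "D (bracket x y) = scl \<mu> (bracket x y)" for x y
  proof -
    have "bracket (D x) y = scl \<mu> (bracket x y)"
      unfolding bracket_formula[of "D x" y] bracket_formula[of x y] XD YD
      by (simp add: form_simps algebra_simps)
    then show ?thesis by (simp only: left)
  qed
  then show ?thesis by blast
qed

text \<open>
  The automorphism that multiplies \<open>X\<close> by \<open>c\<^sup>2\<close>, fixes \<open>Y\<close>, and multiplies the orthogonal
  complement of \<open>X\<close> and \<open>Y\<close> by \<open>c\<close>. It is a similarity of the form because \<open>Y\<close> is isotropic.
\<close>

definition rescale :: "complex \<Rightarrow> 'a \<Rightarrow> 'a"
  where "rescale c x = scl c x + scl ((1 - c) * form X x) Y + scl ((c\<^sup>2 - c) * form Y x) X"

lemma linear_rescale: "Vector_Spaces.linear scl scl (rescale c)"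
  using vector_space_axioms
  by (simp add: Vector_Spaces.linear_iff rescale_def form_simps algebra_simps)

lemma rescale_bracket: "rescale c (bracket x y) = bracket (rescale c x) (rescale c y)"
proof -
  have XX: "form X (rescale c u) = form X u" for u
    by (simp add: rescale_def form_simps form_XX form_XY algebra_simps)
  have YY: "bracket Y (rescale c u) = scl c (bracket Y u)" for u
    by (simp add: rescale_def bracket_simps X_central_right)
  have YB: "form Y (bracket x y) = form (bracket Y x) y"
    using form_invariant by simp
  have cross: "form (bracket Y x) (rescale c y) = c * form (bracket Y x) y"
    by (simp add: rescale_def form_simps form_X_bracket form_Y_bracket)
  have "bracket (rescale c x) (rescale c y) = scl c (scl (form X x) (bracket Y y)
      - scl (form X y) (bracket Y x)) + scl (c\<^sup>2 * form (bracket Y x) y) X"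
    unfolding bracket_formula[of "rescale c x"] XX YY form_scale_left cross
    by (simp add: algebra_simps power2_eq_square)
  also have "scl (form X x) (bracket Y y) - scl (form X y) (bracket Y x)
      = bracket x y - scl (form (bracket Y x) y) X"
    unfolding bracket_formula[of x y] by simp
  finally show ?thesis
    unfolding rescale_def form_X_bracket YB
    by (simp add: algebra_simps)
qed

lemma form_rescale: "form (rescale c x) (rescale c y) = c\<^sup>2 * form x y"
  unfolding rescale_def form_simps form_XX form_YY form_XY form_sym[of Y X]
    form_sym[of x X] form_sym[of x Y]
  by algebra

end

text \<open>
  A polynomial square root of \<open>E\<close> is symmetric since \<open>E\<close> is. On the vectors fixed by \<open>E\<close> it is a
  scalar \<open>\<epsilon>\<close> with \<open>\<epsilon>\<^sup>2 = 1\<close>, and multiplying the root by \<open>\<epsilon>\<close> makes it fix all brackets.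
\<close>

lemma (in quadratic_lie_algebra) symmetric_square_root_exists:
  assumes E: "Vector_Spaces.linear scl scl E"
    and inj: "inj E"
    and sym: "\<And>x y. form (E x) y = form x (E y)"
    and fixed: "\<And>x y. E (bracket x y) = bracket x y"
  shows "\<exists>S. Vector_Spaces.linear scl scl S \<and> (\<forall>x. S (S x) = E x) \<and>
    (\<forall>x y. form (S x) y = form x (S y)) \<and> (\<forall>x y. S (bracket x y) = bracket x y)"
proof -
  interpret L: linear_endomorphism scl E
    by (intro linear_endomorphism.intro linear_endomorphism_axioms.intro vector_space_axioms E)
  obtain A where A: "finite A" "span A = UNIV" using finite_dim by blast
  obtain p where p: "\<And>x. L.poly_map p (L.poly_map p x) = E x"
    using L.square_root_exists[OF A inj] by blast
  have poly_sym: "form (L.poly_map q x) y = form x (L.poly_map q y)" for q x y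
  proof (induction q arbitrary: x y)
    case 0
    then show ?case by (simp add: L.poly_map_0 form_simps)
  next
    case (pCons a q)
    have "E (L.poly_map q y) = L.poly_map q (E y)" 
    proof -
      have "E z = L.poly_map [:0, 1:] z" for z
        by (simp add: L.poly_map_pCons L.poly_map_0 L.T_0)
      then show ?thesis by (metis L.poly_map_mult mult.commute)
    qed
    then show ?case using pCons by (simp add: L.poly_map_pCons form_simps sym)
  qed
  let ?\<epsilon> = "poly p 1"
  have p_fixed: "L.poly_map p (bracket x y) = scl ?\<epsilon> (bracket x y)" for x y
    by (rule L.poly_map_fixed) (rule fixed)
  show ?thesis
  proof (cases abelian)
    case True
    show ?thesis
      by (rule exI[of _ "L.poly_map p"])
        (use True L.linear_poly_map p poly_sym L.poly_map_zero_right in \<open>simp add: abelian_def\<close>)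
  next
    case False
    then obtain x y where nz: "bracket x y \<noteq> 0" by (auto simp: abelian_def)
    have "scl (?\<epsilon> * ?\<epsilon>) (bracket x y) = scl 1 (bracket x y)"
      using p[of "bracket x y"] L.linear_poly_map[of p] fixed
      by (simp add: p_fixed Vector_Spaces.linear_iff)
    then have \<epsilon>: "?\<epsilon> * ?\<epsilon> = 1" using nz scale_right_imp_eq by blast
    have q: "L.poly_map (smult ?\<epsilon> p) x = scl ?\<epsilon> (L.poly_map p x)" for x
      by (rule L.poly_map_smult)
    show ?thesis
    proof (intro exI[of _ "L.poly_map (smult ?\<epsilon> p)"] conjI allI)
      show "L.poly_map (smult ?\<epsilon> p) (L.poly_map (smult ?\<epsilon> p) x) = E x" for x
        using L.linear_poly_map[of p] p[of x] \<epsilon> by (simp add: q Vector_Spaces.linear_iff)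
      show "L.poly_map (smult ?\<epsilon> p) (bracket x y) = bracket x y" for x y
        by (simp add: q p_fixed \<epsilon>)
    qed (rule L.linear_poly_map poly_sym)+
  qed
qed

text \<open>
  The second form is \<open>form (D x) y\<close> with \<open>D\<close> in the centroid, so \<open>D\<close> is a scalar \<open>\<mu>\<close> on all
  brackets and \<open>E = D / \<mu>\<close> fixes them. A symmetric square root \<open>S\<close> of \<open>E\<close> fixing the brackets
  satisfies \<open>[S x, S y] = [x, y] = S [x, y]\<close>: an element of the centroid is an automorphism as
  soon as it is the identity on brackets. It carries the second form, divided by \<open>\<mu>\<close>, to the first,
  and rescaling with \<open>c\<^sup>2 = \<mu>\<close> removes the factor.
\<close>

lemma (in double_extension) isometric_automorphism_exists:
  assumes "quadratic_lie_algebra scl bracket form2"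
  shows "\<exists>\<Phi>. Vector_Spaces.linear scl scl \<Phi> \<and>
    (\<forall>x y. \<Phi> (bracket x y) = bracket (\<Phi> x) (\<Phi> y)) \<and> (\<forall>x y. form (\<Phi> x) (\<Phi> y) = form2 x y)"
proof -
  interpret Q: quadratic_lie_algebra scl bracket form2 by fact
  have "Vector_Spaces.linear scl (*) (form2 x)" for x
    using Q.linear_form_left[of x] by (simp only: Q.form_sym[of _ x])
  then have "\<exists>d. \<forall>y. form d y = form2 x y" for x
    by (rule form_represents)
  then obtain D where D: "\<And>x y. form (D x) y = form2 x y"
    by metis
  have linD: "Vector_Spaces.linear scl scl D"
    using vector_space_axioms unfolding Vector_Spaces.linear_iff
    by (auto intro!: form_eqI simp: form_simps D Q.form_simps)
  have D_scale: "D (scl c x) = scl c (D x)" for c x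
    using linD by (simp add: Vector_Spaces.linear_iff)
  have "D (bracket x y) = bracket (D x) y" for x y
    by (rule form_eqI) (simp add: D Q.form_invariant form_invariant)
  then obtain \<mu> where \<mu>: "\<And>x y. D (bracket x y) = scl \<mu> (bracket x y)"
    using centroid_scalar[OF linD] by blast
  have injD: "D x = D y \<Longrightarrow> x = y" for x y
    using D by (metis Q.form_eqI)
  have "\<mu> \<noteq> 0"
  proof
    assume "\<mu> = 0"
    then have "D (bracket x y) = D 0" for x y using \<mu> D_scale[of 0 0] by simp
    then show False using injD nonabelian by (auto simp: abelian_def)
  qed
  define E where "E x = scl (1 / \<mu>) (D x)" for x
  have formE: "form (E x) y = form2 x y / \<mu>" for x y
    by (simp add: E_def form_simps D)
  have "\<exists>S. Vector_Spaces.linear scl scl S \<and> (\<forall>x. S (S x) = E x) \<and>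
    (\<forall>x y. form (S x) y = form x (S y)) \<and> (\<forall>x y. S (bracket x y) = bracket x y)"
  proof (rule symmetric_square_root_exists)
    show "Vector_Spaces.linear scl scl E"
      using linD unfolding Vector_Spaces.linear_iff E_def[abs_def]
      by (simp add: scale_right_distrib mult.commute)
    show "inj E"
      using \<open>\<mu> \<noteq> 0\<close> injD by (auto simp: E_def inj_def)
    show "form (E x) y = form x (E y)" for x y
      using formE[of x y] formE[of y x] Q.form_sym[of x y] form_sym[of x "E y"] by simp
    show "E (bracket x y) = bracket x y" for x y
      using \<open>\<mu> \<noteq> 0\<close> by (simp add: E_def \<mu>)
  qed
  then obtain S where S: "Vector_Spaces.linear scl scl S" "\<And>x. S (S x) = E x"
    "\<And>x y. form (S x) y = form x (S y)" "\<And>x y. S (bracket x y) = bracket x y"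
    by auto
  \<comment> \<open>Symmetry of \<open>S\<close> turns fixing the brackets into preserving them.\<close>
  have bracket_S: "bracket (S x) y = bracket x y" for x y
    by (rule form_eqI) (simp add: S form_invariant)
  let ?c = "csqrt \<mu>"
  show ?thesis
  proof (intro exI[of _ "rescale ?c \<circ> S"] conjI allI)
    show "Vector_Spaces.linear scl scl (rescale ?c \<circ> S)"
      using S(1) linear_rescale[of ?c] by (simp add: Vector_Spaces.linear_iff)
    have "bracket (S x) (S y) = bracket x y" for x y
      using bracket_S[of x "S y"] bracket_S[of y x] bracket_skew[of x] by simp
    then show "(rescale ?c \<circ> S) (bracket x y) = bracket ((rescale ?c \<circ> S) x) ((rescale ?c \<circ> S) y)" for x y
      by (simp add: S(4) flip: rescale_bracket)
    show "form ((rescale ?c \<circ> S) x) ((rescale ?c \<circ> S) y) = form2 x y" for x y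
      using \<open>\<mu> \<noteq> 0\<close> formE[of x y] S(2,3) by (simp add: form_rescale flip: S(3))
  qed
qed

text \<open>
  Pulling the form of the target back along a Lie isomorphism \<open>f\<close> gives a second invariant form on
  the source. If the automorphism \<open>\<Phi>\<close> transports it to the original form, then \<open>f \<circ> \<Phi>\<inverse>\<close>
  is an isometry.
\<close>

lemma lie_isomorphic_iff_i_isomorphic:
  assumes g: "solvable_singular_quadratic_lie_algebra scl bracket form"
    and g': "solvable_singular_quadratic_lie_algebra scl' bracket' form'"
  shows "lie_isomorphic scl bracket scl' bracket' \<longleftrightarrow>
    i_isomorphic scl bracket form scl' bracket' form'"
proof
  assume "i_isomorphic scl bracket form scl' bracket' form'"
  then show "lie_isomorphic scl bracket scl' bracket'"
    unfolding i_isomorphic_def lie_isomorphic_def by blast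
next
  interpret G: solvable_singular_quadratic_lie_algebra scl bracket form by (rule g)
  interpret G': solvable_singular_quadratic_lie_algebra scl' bracket' form' by (rule g')
  assume "lie_isomorphic scl bracket scl' bracket'"
  then obtain f where f: "Vector_Spaces.linear scl scl' f" "bij f"
    "\<And>x y. f (bracket x y) = bracket' (f x) (f y)"
    unfolding lie_isomorphic_def lie_isomorphism_def by blast
  have f_lin: "f (x + y) = f x + f y" "f (scl c x) = scl' c (f x)" for x y c
    using f(1) by (simp_all add: Vector_Spaces.linear_iff)
  have f0: "f 0 = 0" using f_lin(2)[of 0 0] by simp
  have surj: "\<exists>y. f y = z" for z using surjD[OF bij_is_surj[OF f(2)], of z] by blast
  have f_inj: "x = y" if "f x = f y" for x y
    using injD[OF bij_is_inj[OF f(2)] that] .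
  obtain X Y where "double_extension scl bracket form X Y"
    using G.double_extension_exists[OF G.solvable G.singular] by blast
  then interpret DE: double_extension scl bracket form X Y .
  have "quadratic_lie_algebra scl bracket (\<lambda>x y. form' (f x) (f y))"
  proof (intro quadratic_lie_algebra.intro quadratic_lie_algebra_axioms.intro G.lie_algebra_axioms)
    show "Vector_Spaces.linear scl (*) (\<lambda>x. form' (f x) (f y))" for y
      using G.linear_form_left f_lin
      unfolding Vector_Spaces.linear_iff by (simp add: G'.form_simps)
    show "form' (f x) (f y) = form' (f y) (f x)" for x y by (rule G'.form_sym)
    show "x = 0" if "\<And>y. form' (f x) (f y) = 0" for x
    proof -
      have "form' (f x) z = 0" for z using that surj[of z] by blast
      then have "f x = f 0" using G'.form_nondegenerate f0 by metis
      then show ?thesis by (rule f_inj)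
    qed
    show "form' (f (bracket x y)) (f z) = form' (f x) (f (bracket y z))" for x y z
      by (simp add: f(3) G'.form_invariant)
  qed
  then obtain \<Phi> where \<Phi>: "Vector_Spaces.linear scl scl \<Phi>"
    "\<And>x y. \<Phi> (bracket x y) = bracket (\<Phi> x) (\<Phi> y)"
    "\<And>x y. form (\<Phi> x) (\<Phi> y) = form' (f x) (f y)"
    using DE.isometric_automorphism_exists[of "\<lambda>x y. form' (f x) (f y)"] by auto
  have "inj \<Phi>"
  proof (rule injI)
    fix x y assume "\<Phi> x = \<Phi> y"
    then have "form' (f x) (f z) = form' (f y) (f z)" for z using \<Phi>(3) by metis
    then have "f x = f y" using surj by (metis G'.form_eqI)
    then show "x = y" by (rule f_inj)
  qed
  moreover obtain Ba where "finite_dimensional_vector_space scl Ba" using G.finite_dimensional ..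
  then have "surj \<Phi>"
    using finite_dimensional_vector_space.linear_inj_imp_surj \<Phi>(1) \<open>inj \<Phi>\<close> by blast
  ultimately have bij: "bij \<Phi>" by (rule bijI)
  define h where "h = inv \<Phi>"
  have h: "\<Phi> (h x) = x" "h (\<Phi> x) = x" for x
    using \<open>inj \<Phi>\<close> \<open>surj \<Phi>\<close> by (simp_all add: h_def surj_f_inv_f)
  have \<Phi>_lin: "\<Phi> (x + y) = \<Phi> x + \<Phi> y" "\<Phi> (scl c x) = scl c (\<Phi> x)" for x y c
    using \<Phi>(1) by (simp_all add: Vector_Spaces.linear_iff)
  have h_lin: "h (x + y) = h x + h y" "h (scl c x) = scl c (h x)"
    "h (bracket x y) = bracket (h x) (h y)" for x y c
    using \<open>inj \<Phi>\<close> by (auto intro: injD simp: h \<Phi>_lin \<Phi>(2))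
  have "bij (f \<circ> h)" using f(2) bij by (simp add: h_def bij_comp bij_imp_bij_inv)
  then have "lie_isomorphism scl bracket scl' bracket' (f \<circ> h)"
    using f(1) by (simp add: lie_isomorphism_def Vector_Spaces.linear_iff h_lin f(3))
  moreover have "form' ((f \<circ> h) x) ((f \<circ> h) y) = form x y" for x y
    using \<Phi>(3)[of "h x" "h y"] by (simp add: h)
  ultimately show "i_isomorphic scl bracket form scl' bracket' form'"
    unfolding i_isomorphic_def by blast
qed

lemma iso_classes_eq_i_iso_classes:
  "(iso_classes :: (complex ^ 'm \<Rightarrow> complex ^ 'm \<Rightarrow> complex ^ 'm) set set) = i_iso_classes"
proof -
  have "lie_isomorphic (*s) b (*s) b' \<longleftrightarrow> i_isomorphic (*s) b canonical_form (*s) b' canonical_form"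
    if "b \<in> solvable_singular_structures" "b' \<in> solvable_singular_structures"
    for b b' :: "complex ^ 'm \<Rightarrow> complex ^ 'm \<Rightarrow> complex ^ 'm"
    by (rule lie_isomorphic_iff_i_isomorphic)
      (use that in \<open>simp_all add: solvable_singular_structures_def\<close>)
  then show ?thesis
    unfolding iso_classes_def i_iso_classes_def
    by (intro arg_cong2[where f = "(//)"] refl Collect_cong) auto
qed

theorem theorem6:
  fixes scl :: "complex \<Rightarrow> 'a::ab_group_add \<Rightarrow> 'a"
    and bracket :: "'a \<Rightarrow> 'a \<Rightarrow> 'a"
    and form :: "'a \<Rightarrow> 'a \<Rightarrow> complex"
    and scl' :: "complex \<Rightarrow> 'b::ab_group_add \<Rightarrow> 'b"
    and bracket' :: "'b \<Rightarrow> 'b \<Rightarrow> 'b"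
    and form' :: "'b \<Rightarrow> 'b \<Rightarrow> complex"
    and n :: nat
  shows "(solvable_singular_quadratic_lie_algebra scl bracket form \<longrightarrow>
          solvable_singular_quadratic_lie_algebra scl' bracket' form' \<longrightarrow>
          (lie_isomorphic scl bracket scl' bracket' \<longleftrightarrow>
           i_isomorphic scl bracket form scl' bracket' form')) \<and>
         (n \<ge> 2 \<longrightarrow> CARD('m::finite) = n + 2 \<longrightarrow>
          (iso_classes :: (complex ^ 'm \<Rightarrow> complex ^ 'm \<Rightarrow> complex ^ 'm) set set) = i_iso_classes)"
  by (intro conjI impI lie_isomorphic_iff_i_isomorphic iso_classes_eq_i_iso_classes)

end
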